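(* Let $\mathcal{V}$ be a risk-averse expected disutility function, $\Phi=\mathcal{V}^*$ on $\mathcal{L}$, and $\mathcal{R}(X):=\min_{t\in\mathbb{R}}\{t+\mathcal{V}(X-t)\}$ for $X\in\mathcal{M}$. Let $\sigma>0$ and $M_N\in\mathcal{M}$. Then the GVI problem $$\sup_{p\in\mathfrak{D}}\{\mathbb{E}[pM_N]-\sigma\Phi(p)\}$$ has a solution if and only if $$\partial\mathcal{R}(\sigma^{-1}M_N)\cap\mathcal{L}\neq\emptyset,$$ and any solution (variational density) $\bar p$ is a risk identifier of $\sigma^{-1}M_N$, i.e., $\bar p\in\partial\mathcal{R}(\sigma^{-1}M_N)\cap\mathcal{L}$.
   Context: $(\Theta,\mathcal{B},\Pi)$ is a complete probability space and $\mathbb{E}$ is expectation with respect to $\Pi$. $\mathcal{L}$ and $\mathcal{M}$ are Banach spaces of ($\Pi$-a.s. equivalence classes of) $\mathcal{B}$-measurable functions $\Theta\to\mathbb{R}$, both containing all simple functions, such that $\mathbb{E}[|pX|]<\infty$ for all $p\in\mathcal{L}$, $X\in\mathcal{M}$. They are paired by $\langle p,X\rangle=\mathbb{E}[pX]$; through this pairing $\mathcal{L}$ is identified with a subspace of the topological dual $\mathcal{M}^*$ and $\mathcal{M}$ with a subspace of $\mathcal{L}^*$, and it is assumed that $\mathcal{L}=\mathcal{M}^*$ or $\mathcal{M}=\mathcal{L}^*$. $\sigma(\mathcal{M},\mathcal{L})$ denotes the weak topology on $\mathcal{M}$ induced by the pairing. $\mathcal{V}:\mathcal{M}\to[-\infty,+\infty]$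 is a risk-averse expected disutility function if: (V1) $\mathcal{V}$ is proper, $\sigma(\mathcal{M},\mathcal{L})$-lower semicontinuous and convex; (V2) $\mathcal{V}(X)\ge\mathbb{E}[X]$ for all $X\in\mathcal{M}$, with $\mathcal{V}(X)=\mathbb{E}[X]$ if and only if $X\equiv 0$; (V3) if $X,X'\in\mathcal{M}$ and $X\le X'$ a.s., then $\mathcal{V}(X)\le\mathcal{V}(X')$. $\Phi(p)=\mathcal{V}^*(p)=\sup_{X\in\mathcal{M}}\{\mathbb{E}[pX]-\mathcal{V}(X)\}$ for $p\in\mathcal{L}$. $\mathfrak{D}$ is the set of $\mathcal{B}$-measurable $p\ge 0$ with $\mathbb{E}[p]=1$; densities not in $\mathcal{L}$ are regarded as having $\Phi(p)=+\infty$ (objective value $-\infty$). $M_N(\theta)=\frac1N\sum_{n=1}^N m(\theta,y_n)$ is the pay-off function for fixed data $y_1,\dots,y_N$ in a data space $\Upsilon$ and $m:\Theta\times\Upsilon\to\mathbb{R}$. $\partial f(x)=\{\eta\in\mathcal{M}^*: f(x')-f(x)\ge\langle\eta,x'-x\rangle\ \forall x'\in\mathcal{M}\}$ is the convex subdifferential; elements of $\partial\mathcal{R}(X)$ are called risk identifiers at $X$. *)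

theory Defs
  imports "HOL-Probability.Probability"
begin

section \<open>Paired Banach spaces of random variables\<close>

text \<open>
  A Banach space of a.s. equivalence classes of measurable functions is a type of class
  \<open>banach\<close> together with a map \<open>\<iota>\<close> that selects, for every element of the space,
  a representative of the equivalence class which this element is. Linearity of \<open>\<iota>\<close>
  therefore holds only almost surely, and elements with a.s. equal representatives coincide.
\<close>

definition function_space :: "'a measure \<Rightarrow> ('b::banach \<Rightarrow> 'a \<Rightarrow> real) \<Rightarrow> bool" where
  "function_space P \<iota> \<longleftrightarrow>
     (\<forall>x. \<iota> x \<in> borel_measurable P) \<and>
     (\<forall>x y. AE \<theta> in P. \<iota> (x + y) \<theta> = \<iota> x \<theta> + \<iota> y \<theta>) \<and>
     (\<forall>c x. AE \<theta> in P. \<iota> (c *\<^sub>R x) \<theta> = c * \<iota> x \<theta>) \<and>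
     (\<forall>x y. (AE \<theta> in P. \<iota> x \<theta> = \<iota> y \<theta>) \<longrightarrow> x = y) \<and>
     (\<forall>f. simple_function P f \<longrightarrow> (\<exists>x. AE \<theta> in P. \<iota> x \<theta> = f \<theta>))"

definition in_space :: "'a measure \<Rightarrow> ('b \<Rightarrow> 'a \<Rightarrow> real) \<Rightarrow> ('a \<Rightarrow> real) \<Rightarrow> bool" where
  "in_space P \<iota> f \<longleftrightarrow> (\<exists>x. AE \<theta> in P. \<iota> x \<theta> = f \<theta>)"

text \<open>Only meaningful if \<^term>\<open>in_space P \<iota> f\<close>.\<close>

definition class_of :: "'a measure \<Rightarrow> ('b \<Rightarrow> 'a \<Rightarrow> real) \<Rightarrow> ('a \<Rightarrow> real) \<Rightarrow> 'b" where
  "class_of P \<iota> f = (THE x. AE \<theta> in P. \<iota> x \<theta> = f \<theta>)"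

definition pairing ::
  "'a measure \<Rightarrow> ('l \<Rightarrow> 'a \<Rightarrow> real) \<Rightarrow> ('m \<Rightarrow> 'a \<Rightarrow> real) \<Rightarrow> 'l \<Rightarrow> 'm \<Rightarrow> real" where
  "pairing P \<iota>L \<iota>M p X = (\<integral>\<theta>. \<iota>L p \<theta> * \<iota>M X \<theta> \<partial>P)"

text \<open>
  The two bounded linearity conditions say that the pairing maps each of the spaces into
  the topological dual of the other one; the final disjunction says that one of these two
  maps is onto. No isometry is required.
\<close>

definition paired_spaces ::
  "'a measure \<Rightarrow> ('l::banach \<Rightarrow> 'a \<Rightarrow> real) \<Rightarrow> ('m::banach \<Rightarrow> 'a \<Rightarrow> real) \<Rightarrow> bool" where
  "paired_spaces P \<iota>L \<iota>M \<longleftrightarrow>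
     function_space P \<iota>L \<and> function_space P \<iota>M \<and>
     (\<forall>p X. integrable P (\<lambda>\<theta>. \<iota>L p \<theta> * \<iota>M X \<theta>)) \<and>
     (\<forall>p. bounded_linear (pairing P \<iota>L \<iota>M p)) \<and>
     (\<forall>X. bounded_linear (\<lambda>p. pairing P \<iota>L \<iota>M p X)) \<and>
     ((\<forall>f. bounded_linear f \<longrightarrow> (\<exists>p. f = pairing P \<iota>L \<iota>M p)) \<or>
      (\<forall>f. bounded_linear f \<longrightarrow> (\<exists>X. f = (\<lambda>p. pairing P \<iota>L \<iota>M p X))))"

definition dual_of ::
  "'a measure \<Rightarrow> ('l \<Rightarrow> 'a \<Rightarrow> real) \<Rightarrow> ('m::banach \<Rightarrow> 'a \<Rightarrow> real) \<Rightarrow> 'l \<Rightarrow> ('m \<Rightarrow>\<^sub>L real)" where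
  "dual_of P \<iota>L \<iota>M p = Blinfun (pairing P \<iota>L \<iota>M p)"

definition weak_topology ::
  "'a measure \<Rightarrow> ('l \<Rightarrow> 'a \<Rightarrow> real) \<Rightarrow> ('m \<Rightarrow> 'a \<Rightarrow> real) \<Rightarrow> 'm topology" where
  "weak_topology P \<iota>L \<iota>M =
     topology_generated_by {pairing P \<iota>L \<iota>M p -` U |p U. open U}"


section \<open>Extended-real-valued functions\<close>

definition proper_fun :: "('b \<Rightarrow> ereal) \<Rightarrow> bool" where
  "proper_fun f \<longleftrightarrow> (\<forall>x. f x \<noteq> -\<infinity>) \<and> (\<exists>x. f x \<noteq> \<infinity>)"

definition lsc_in :: "'b topology \<Rightarrow> ('b \<Rightarrow> ereal) \<Rightarrow> bool" where
  "lsc_in T f \<longleftrightarrow> (\<forall>a. closedin T {x \<in> topspace T. f x \<le> a})"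

text \<open>Convexity of the epigraph, which avoids sums of opposite infinities.\<close>

definition convex_fun :: "('b::real_vector \<Rightarrow> ereal) \<Rightarrow> bool" where
  "convex_fun f \<longleftrightarrow> convex {(x, r::real). f x \<le> ereal r}"

text \<open>
  The finiteness requirement on \<^term>\<open>f x\<close> makes the difference well-defined. For proper
  \<^term>\<open>f\<close> it excludes only the points where \<^term>\<open>f x = \<infinity>\<close>, at which the subgradient
  inequality fails for \<^term>\<open>x'\<close> in the effective domain.
\<close>

definition subdifferential :: "('b::real_normed_vector \<Rightarrow> ereal) \<Rightarrow> 'b \<Rightarrow> ('b \<Rightarrow>\<^sub>L real) set" where
  "subdifferential f x =
     {\<eta>. \<bar>f x\<bar> \<noteq> \<infinity> \<and> (\<forall>x'. f x' - f x \<ge> ereal (blinfun_apply \<eta> (x' - x)))}"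


section \<open>Expected disutility, risk, and generalised variational inference\<close>

definition risk_averse_disutility ::
  "'a measure \<Rightarrow> ('l \<Rightarrow> 'a \<Rightarrow> real) \<Rightarrow> ('m::banach \<Rightarrow> 'a \<Rightarrow> real) \<Rightarrow> ('m \<Rightarrow> ereal) \<Rightarrow> bool" where
  "risk_averse_disutility P \<iota>L \<iota>M V \<longleftrightarrow>
     proper_fun V \<and> lsc_in (weak_topology P \<iota>L \<iota>M) V \<and> convex_fun V \<and>
     (\<forall>X. V X \<ge> ereal (\<integral>\<theta>. \<iota>M X \<theta> \<partial>P)) \<and>
     (\<forall>X. V X = ereal (\<integral>\<theta>. \<iota>M X \<theta> \<partial>P) \<longleftrightarrow> X = 0) \<and>
     (\<forall>X X'. (AE \<theta> in P. \<iota>M X \<theta> \<le> \<iota>M X' \<theta>) \<longrightarrow> V X \<le> V X')"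

text \<open>The infimum in this definition is a minimum iff it is attained for each \<^term>\<open>X\<close>.\<close>

definition risk ::
  "'a measure \<Rightarrow> ('m::banach \<Rightarrow> 'a \<Rightarrow> real) \<Rightarrow> ('m \<Rightarrow> ereal) \<Rightarrow> 'm \<Rightarrow> ereal" where
  "risk P \<iota>M V X = (INF t::real. ereal t + V (X - class_of P \<iota>M (\<lambda>_. t)))"

definition conj_disutility ::
  "'a measure \<Rightarrow> ('l \<Rightarrow> 'a \<Rightarrow> real) \<Rightarrow> ('m \<Rightarrow> 'a \<Rightarrow> real) \<Rightarrow> ('m \<Rightarrow> ereal) \<Rightarrow> 'l \<Rightarrow> ereal" where
  "conj_disutility P \<iota>L \<iota>M V p = (SUP X. ereal (pairing P \<iota>L \<iota>M p X) - V X)"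

text \<open>
  The Bochner integral of a non-integrable function is 0, so the normalisation entails
  integrability.
\<close>

definition densities :: "'a measure \<Rightarrow> ('a \<Rightarrow> real) set" where
  "densities P = {q \<in> borel_measurable P. (AE \<theta> in P. 0 \<le> q \<theta>) \<and> (\<integral>\<theta>. q \<theta> \<partial>P) = 1}"

definition gvi_objective ::
  "'a measure \<Rightarrow> ('l \<Rightarrow> 'a \<Rightarrow> real) \<Rightarrow> ('m \<Rightarrow> 'a \<Rightarrow> real) \<Rightarrow> ('m \<Rightarrow> ereal) \<Rightarrow> real \<Rightarrow>
   ('a \<Rightarrow> real) \<Rightarrow> ('a \<Rightarrow> real) \<Rightarrow> ereal" where
  "gvi_objective P \<iota>L \<iota>M V \<sigma> f q =
     (if in_space P \<iota>L q
      then ereal (\<integral>\<theta>. q \<theta> * f \<theta> \<partial>P) - ereal \<sigma> * conj_disutility P \<iota>L \<iota>M V (class_of P \<iota>L q)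
      else -\<infinity>)"

definition gvi_solution ::
  "'a measure \<Rightarrow> ('l \<Rightarrow> 'a \<Rightarrow> real) \<Rightarrow> ('m \<Rightarrow> 'a \<Rightarrow> real) \<Rightarrow> ('m \<Rightarrow> ereal) \<Rightarrow> real \<Rightarrow>
   ('a \<Rightarrow> real) \<Rightarrow> ('a \<Rightarrow> real) \<Rightarrow> bool" where
  "gvi_solution P \<iota>L \<iota>M V \<sigma> f q \<longleftrightarrow>
     q \<in> densities P \<and>
     gvi_objective P \<iota>L \<iota>M V \<sigma> f q = (SUP q'\<in>densities P. gvi_objective P \<iota>L \<iota>M V \<sigma> f q')"

definition payoff :: "('a \<Rightarrow> 'y \<Rightarrow> real) \<Rightarrow> (nat \<Rightarrow> 'y) \<Rightarrow> nat \<Rightarrow> 'a \<Rightarrow> real" where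
  "payoff m y N \<theta> = (1 / real N) * (\<Sum>n=1..N. m \<theta> (y n))"

end

theory Submission
  imports Defs
begin

text \<open>
  The value of the GVI problem is \<open>\<sigma>\<close> times the biconjugate of the risk measure \<open>R\<close> at
  \<open>\<sigma>\<inverse> M\<^sub>N\<close>: an affine function \<open>a + \<langle>p, \<cdot> - X\<rangle>\<close> minorises \<open>R\<close> iff \<open>p\<close> is a density with
  \<open>\<Phi>(p) \<le> \<langle>p, X\<rangle> - a\<close>, translation giving \<open>E[p] = 1\<close> and monotonicity giving \<open>p \<ge> 0\<close>. So everything
  rests on \<open>R\<close> being convex and weakly lower semicontinuous, and on separation.

  Semicontinuity and attainment both come from a recession argument: if
  \<open>t + V(X - t) \<le> a\<close> with \<open>X\<close> near \<open>X\<^sub>0\<close> and \<open>\<bar>t\<bar>\<close> large, convexity with \<open>V(0) = 0\<close> bounds \<open>V\<close> at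
  \<open>(X - t) / \<bar>t\<bar>\<close>, which is weakly close to \<open>\<plusminus>1\<close>, and this contradicts \<open>V(\<plusminus>1) > \<plusminus>1\<close>; bounded
  \<open>t\<close> are handled by compactness. Separation needs no Hahn-Banach theorem, because a weak
  neighbourhood involves only finitely many functionals, so that the nearest-point argument in
  finite dimension applies.
\<close>

section \<open>Separation and weak neighbourhoods\<close>

text \<open>The set consists of functions on a finite index set, not of vectors of a Euclidean type,
  because the coordinates are functionals found only inside the proof of
  \<open>affine_minorant\<close>.\<close>

lemma box_separation:
  fixes S :: "('i \<Rightarrow> real) set"
  assumes "finite I"
    and conv: "\<And>g h u. g \<in> S \<Longrightarrow> h \<in> S \<Longrightarrow> 0 \<le> u \<Longrightarrow> u \<le> 1 \<Longrightarrow> (\<lambda>i. (1 - u) * g i + u * h i) \<in> S"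
    and "\<epsilon> > 0" and far: "\<And>g. g \<in> S \<Longrightarrow> \<exists>i\<in>I. \<epsilon> \<le> \<bar>g i\<bar>"
  shows "\<exists>c d. d > 0 \<and> (\<forall>g\<in>S. d \<le> (\<Sum>i\<in>I. c i * g i))"
proof (cases "S = {}")
  case True
  then show ?thesis by (auto intro: exI[of _ 1])
next
  case False
  text \<open>Minimising sequences for \<open>q\<close> converge by the parallelogram law; the limit, a nearest point to
    the origin in the closure of \<open>S\<close>, gives the separating coefficients.\<close>
  define q where "q g = (\<Sum>i\<in>I. (g i)\<^sup>2)" for g :: "'i \<Rightarrow> real"
  have q_nonneg: "0 \<le> q g" for g
    unfolding q_def by (simp add: sum_nonneg)
  have coord: "(g i)\<^sup>2 \<le> q g" if "i \<in> I" for g i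
    unfolding q_def using that \<open>finite I\<close> by (intro member_le_sum) auto
  have q_ge: "\<epsilon>\<^sup>2 \<le> q g" if "g \<in> S" for g
  proof -
    obtain i where "i \<in> I" "\<epsilon> \<le> \<bar>g i\<bar>" using far[OF \<open>g \<in> S\<close>] by blast
    then have "\<epsilon>\<^sup>2 \<le> (g i)\<^sup>2" using \<open>\<epsilon> > 0\<close> by (metis abs_of_pos abs_le_square_iff)
    then show ?thesis using coord[OF \<open>i \<in> I\<close>, of g] by linarith
  qed
  define d where "d = Inf (q ` S)"
  have bdd: "bdd_below (q ` S)" using q_nonneg by (intro bdd_belowI[of _ 0]) auto
  have d_le: "d \<le> q g" if "g \<in> S" for g
    unfolding d_def using that bdd by (intro cInf_lower) auto
  have "\<epsilon>\<^sup>2 \<le> d"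
    unfolding d_def using False q_ge by (intro cInf_greatest) auto
  then have "d > 0" using \<open>\<epsilon> > 0\<close> by (smt (verit) zero_less_power)
  have "\<exists>g\<in>S. q g < d + inverse (real (Suc n))" for n
  proof -
    have "Inf (q ` S) < d + inverse (real (Suc n))" by (simp add: d_def)
    then show ?thesis using False bdd by (subst (asm) cInf_less_iff) auto
  qed
  then obtain g where gS: "\<And>n. g n \<in> S" and g_lt: "\<And>n. q (g n) < d + inverse (real (Suc n))"
    by metis
  have par: "q (\<lambda>i. g n i - g m i) \<le> 2 * inverse (real (Suc n)) + 2 * inverse (real (Suc m))" for n m
  proof -
    have "d \<le> q (\<lambda>i. (1 - 1/2) * g n i + 1/2 * g m i)"
      by (intro d_le conv gS) auto
    moreover have "q (\<lambda>i. g n i - g m i) = 2 * q (g n) + 2 * q (g m) - 4 * q (\<lambda>i. (1 - 1/2) * g n i + 1/2 * g m i)"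
      unfolding q_def sum_distrib_left sum.distrib[symmetric] sum_subtractf[symmetric]
      by (intro sum.cong) (auto simp: power2_eq_square field_simps)
    ultimately show ?thesis using g_lt[of n] g_lt[of m] by linarith
  qed
  have "Cauchy (\<lambda>n. g n i)" if "i \<in> I" for i
  proof (rule metric_CauchyI)
    fix e :: real assume "e > 0"
    obtain N where N: "inverse (real (Suc N)) < e\<^sup>2 / 4"
      using reals_Archimedean[of "e\<^sup>2 / 4"] \<open>e > 0\<close> by auto
    have "dist (g n i) (g m i) < e" if "n \<ge> N" "m \<ge> N" for n m
    proof -
      have "inverse (real (Suc k)) \<le> inverse (real (Suc N))" if "k \<ge> N" for k
        using that by (intro le_imp_inverse_le) auto
      from this[OF that(1)] this[OF that(2)] have "(g n i - g m i)\<^sup>2 < e\<^sup>2"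
        using coord[OF \<open>i \<in> I\<close>, of "\<lambda>i. g n i - g m i"] par[of n m] N by linarith
      then show ?thesis using \<open>e > 0\<close> using abs_le_square_iff[of e "g n i - g m i"] by (simp add: dist_real_def)
    qed
    then show "\<exists>N. \<forall>m\<ge>N. \<forall>n\<ge>N. dist (g m i) (g n i) < e" by blast
  qed
  then have "\<forall>i\<in>I. \<exists>l. (\<lambda>n. g n i) \<longlonglongrightarrow> l"
    by (simp add: Cauchy_convergent_iff convergent_def)
  then have "\<exists>c. \<forall>i\<in>I. (\<lambda>n. g n i) \<longlonglongrightarrow> c i"
    by (rule bchoice)
  then obtain c where c: "\<And>i. i \<in> I \<Longrightarrow> (\<lambda>n. g n i) \<longlonglongrightarrow> c i" by blast
  have "(\<lambda>n. q (g n)) \<longlonglongrightarrow> q c"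
    unfolding q_def by (intro tendsto_intros c)
  moreover have "(\<lambda>n. d + inverse (real (Suc n))) \<longlonglongrightarrow> d + 0"
    by (intro tendsto_intros LIMSEQ_inverse_real_of_nat)
  ultimately have "q c \<le> d"
    using g_lt by (intro LIMSEQ_le[of "\<lambda>n. q (g n)" _ "\<lambda>n. d + inverse (real (Suc n))"]) (auto intro: less_imp_le)
  have "d \<le> (\<Sum>i\<in>I. c i * h i)" if "h \<in> S" for h
  proof -
    \<comment> \<open>The limit \<open>c\<close> need not lie in \<open>S\<close>, so points between
      \<open>c\<close> and \<open>h\<close> are approximated through \<open>g n\<close>. Dividing by
      \<open>t\<close> and letting \<open>t\<close> tend to 0 then turns minimality of
      \<open>c\<close> into a linear inequality.\<close>
    have ineq: "0 \<le> 2 * t * ((\<Sum>i\<in>I. c i * h i) - q c) + t\<^sup>2 * q (\<lambda>i. h i - c i)" if "0 < t" "t \<le> 1" for t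
    proof -
      have "(\<lambda>n. q (\<lambda>i. (1 - t) * g n i + t * h i)) \<longlonglongrightarrow> q (\<lambda>i. (1 - t) * c i + t * h i)"
        unfolding q_def by (intro tendsto_intros c)
      then have "d \<le> q (\<lambda>i. (1 - t) * c i + t * h i)"
        by (rule LIMSEQ_le_const) (use that in \<open>auto intro!: d_le conv gS \<open>h \<in> S\<close>\<close>)
      moreover have "q (\<lambda>i. (1 - t) * c i + t * h i) = q c + (2 * t * ((\<Sum>i\<in>I. c i * h i) - q c) + t\<^sup>2 * q (\<lambda>i. h i - c i))"
        unfolding q_def sum_distrib_left sum.distrib[symmetric] sum_subtractf[symmetric]
        by (intro sum.cong) (auto simp: power2_eq_square field_simps)
      ultimately show ?thesis using \<open>q c \<le> d\<close> by linarith
    qed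
    have "((\<lambda>t. 2 * ((\<Sum>i\<in>I. c i * h i) - q c) + t * q (\<lambda>i. h i - c i))
        \<longlongrightarrow> 2 * ((\<Sum>i\<in>I. c i * h i) - q c) + 0 * q (\<lambda>i. h i - c i)) (at_right 0)"
      by (intro tendsto_intros)
    moreover have "eventually (\<lambda>t. 0 \<le> 2 * ((\<Sum>i\<in>I. c i * h i) - q c) + t * q (\<lambda>i. h i - c i)) (at_right 0)"
      unfolding eventually_at_right_field
    proof (intro exI[of _ 1] conjI allI impI)
      fix t :: real assume "0 < t" "t < 1"
      then have "0 \<le> t * (2 * ((\<Sum>i\<in>I. c i * h i) - q c) + t * q (\<lambda>i. h i - c i))"
        using ineq[of t] by (simp add: power2_eq_square algebra_simps)
      then show "0 \<le> 2 * ((\<Sum>i\<in>I. c i * h i) - q c) + t * q (\<lambda>i. h i - c i)"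
        using \<open>0 < t\<close> by (simp add: zero_le_mult_iff)
    qed simp
    ultimately have "0 \<le> 2 * ((\<Sum>i\<in>I. c i * h i) - q c)"
      using tendsto_lowerbound[of _ _ "at_right 0" 0] by fastforce
    moreover have "d \<le> q c"
      using \<open>(\<lambda>n. q (g n)) \<longlonglongrightarrow> q c\<close> by (rule LIMSEQ_le_const) (auto intro: d_le gS)
    ultimately show ?thesis by simp
  qed
  with \<open>d > 0\<close> show ?thesis by blast
qed

text \<open>On a Banach space type \<open>nhds\<close> refers to the norm, so the weak topology
  enters as a filter that pulls back the neighbourhoods of the values \<open>B p x\<close>.\<close>

definition weak_nhds :: "('l \<Rightarrow> 'm \<Rightarrow> real) \<Rightarrow> 'm \<Rightarrow> 'm filter" where
  "weak_nhds B x = (INF p. filtercomap (B p) (nhds (B p x)))"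

lemma filterlim_weak_nhds:
  "filterlim g (weak_nhds B x) F \<longleftrightarrow> (\<forall>p. ((\<lambda>z. B p (g z)) \<longlongrightarrow> B p x) F)"
  by (simp add: weak_nhds_def filterlim_INF filterlim_filtercomap_iff comp_def)

lemma tendsto_weak_nhds: "(B p \<longlongrightarrow> B p x) (weak_nhds B x)"
  using filterlim_weak_nhds[of "\<lambda>y. y" B x "weak_nhds B x"] by (simp add: filterlim_ident)

lemma eventually_weak_nhds_imp:
  assumes "eventually Q (weak_nhds B x)" shows "Q x"
proof -
  have "filterlim (\<lambda>y. y) (weak_nhds B x) (principal {x})"
    unfolding filterlim_weak_nhds
    by (auto intro!: tendsto_eventually simp: eventually_principal)
  then have "eventually Q (principal {x})"
    using assms by (simp add: filterlim_iff)
  then show ?thesis by (simp add: eventually_principal)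
qed

lemma eventually_weak_nhds_box:
  assumes "eventually Q (weak_nhds B x)"
  shows "\<exists>I \<epsilon>. finite I \<and> \<epsilon> > 0 \<and> (\<forall>y. (\<forall>p\<in>I. \<bar>B p y - B p x\<bar> < \<epsilon>) \<longrightarrow> Q y)"
proof -
  obtain I where "finite I" "eventually Q (INF p\<in>I. filtercomap (B p) (nhds (B p x)))"
    using assms unfolding weak_nhds_def by (subst (asm) eventually_INF) auto
  then have "\<exists>\<epsilon>>0. \<forall>y. (\<forall>p\<in>I. \<bar>B p y - B p x\<bar> < \<epsilon>) \<longrightarrow> Q y"
  proof (induction I arbitrary: Q)
    case empty
    then show ?case by (auto intro: exI[of _ 1])
  next
    case (insert p I)
    then obtain Q1 Q2 where Q: "eventually Q1 (filtercomap (B p) (nhds (B p x)))"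
        "eventually Q2 (INF p\<in>I. filtercomap (B p) (nhds (B p x)))" "\<And>y. Q1 y \<Longrightarrow> Q2 y \<Longrightarrow> Q y"
      by (auto simp: eventually_inf)
    obtain e1 where "e1 > 0" "\<And>y. \<bar>B p y - B p x\<bar> < e1 \<Longrightarrow> Q1 y"
      using Q(1) by (auto simp: eventually_filtercomap eventually_nhds_metric dist_real_def)
    moreover obtain e2 where "e2 > 0" "\<And>y. (\<forall>p\<in>I. \<bar>B p y - B p x\<bar> < e2) \<Longrightarrow> Q2 y"
      using insert.IH[OF Q(2)] by auto
    ultimately show ?case
      by (intro exI[of _ "min e1 e2"]) (auto intro!: Q(3))
  qed
  with \<open>finite I\<close> show ?thesis by blast
qed

text \<open>By induction over the generation of open sets from the subbasis, a weakly open set is a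
  weak neighbourhood of each of its points; the complement of a closed sublevel set is such a
  set.\<close>

lemma lsc_in_weak_topology:
  assumes "lsc_in (weak_topology P \<iota>L \<iota>M) V" "a < V x"
  shows "eventually (\<lambda>y. a < V y) (weak_nhds (pairing P \<iota>L \<iota>M) x)"
proof -
  let ?B = "pairing P \<iota>L \<iota>M"
  let ?S = "{?B p -` U |p U. open U}"
  have nb: "eventually (\<lambda>y. y \<in> W) (weak_nhds ?B x)" if "generate_topology_on ?S W" "x \<in> W" for W
    using that
  proof (induction rule: generate_topology_on.induct)
    case (Int a b)
    then show ?case by (auto intro: eventually_conj)
  next
    case (UN K)
    then obtain k where "k \<in> K" "x \<in> k" by blast
    then have "eventually (\<lambda>y. y \<in> k) (weak_nhds ?B x)" by (rule UN.IH)
    then show ?case by (rule eventually_mono) (use \<open>k \<in> K\<close> in blast)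
  next
    case (Basis s)
    then obtain p U where "s = ?B p -` U" "open U" by blast
    with Basis show ?case
      using topological_tendstoD[OF tendsto_weak_nhds, of U ?B p x] by simp
  qed simp
  have top: "topspace (weak_topology P \<iota>L \<iota>M) = UNIV"
    unfolding weak_topology_def topology_generated_by_topspace by blast
  have "openin (weak_topology P \<iota>L \<iota>M) (- {y. V y \<le> a})"
    using assms(1) top unfolding lsc_in_def by (auto simp: closedin_def Compl_eq_Diff_UNIV)
  then have "generate_topology_on ?S (- {y. V y \<le> a})"
    unfolding weak_topology_def openin_topology_generated_by_iff .
  from nb[OF this] assms(2) show ?thesis by (simp add: not_le)
qed

lemma convex_funD:
  assumes "convex_fun V" "V x \<le> ereal r" "V y \<le> ereal s" "0 \<le> u" "u \<le> 1"
  shows "V ((1 - u) *\<^sub>R x + u *\<^sub>R y) \<le> ereal ((1 - u) * r + u * s)"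
  using assms(1)[unfolded convex_fun_def, THEN convexD, of "(x, r)" "(y, s)" "1 - u" u] assms(2-)
  by simp

text \<open>Finitely many functionals together with the height map the epigraph of \<open>F\<close>
  to a convex set that avoids a box around the image of \<open>(x, a)\<close>. The given minorant
  \<open>B e\<close> serves the case of a vertical separating hyperplane.\<close>

lemma affine_minorant:
  fixes B :: "'l::real_vector \<Rightarrow> 'm::real_vector \<Rightarrow> real" and F :: "'m \<Rightarrow> ereal"
  assumes bil: "bilinear B" and conv: "convex_fun F" and le: "\<And>y. ereal (B e y) \<le> F y"
    and ev: "eventually (\<lambda>y. ereal b < F y) (weak_nhds B x)" and "a < b"
  shows "\<exists>p. \<forall>y. ereal (a + B p (y - x)) \<le> F y"
proof -
  obtain I \<epsilon> where I: "finite I" "\<epsilon> > 0"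
      and box: "\<forall>y. (\<forall>p\<in>I. \<bar>B p y - B p x\<bar> < \<epsilon>) \<longrightarrow> ereal b < F y"
    using eventually_weak_nhds_box[OF ev] by (elim exE conjE)
  \<comment> \<open>Coordinates relative to \<open>(x, a)\<close>: \<open>None\<close> is the
    height, \<open>Some p\<close> the functional \<open>p\<close>. Where all functionals are within
    \<open>\<epsilon>\<close>, the height exceeds \<open>b\<close>; hence the radius
    \<open>min \<epsilon> (b - a)\<close> below.\<close>
  define G where "G = (\<lambda>(y, r) i. case i of None \<Rightarrow> r - a | Some p \<Rightarrow> B p (y - x))"
  have "\<exists>c d. d > 0 \<and> (\<forall>g\<in>G ` {(y, r). F y \<le> ereal r}. d \<le> (\<Sum>i\<in>insert None (Some ` I). c i * g i))"
  proof (rule box_separation[where \<epsilon> = "min \<epsilon> (b - a)"])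
    fix g h and u :: real
    assume "g \<in> G ` {(y, r). F y \<le> ereal r}" "h \<in> G ` {(y, r). F y \<le> ereal r}" and u: "0 \<le> u" "u \<le> 1"
    then obtain y r z s where g: "g = G (y, r)" "F y \<le> ereal r" and h: "h = G (z, s)" "F z \<le> ereal s"
      by auto
    have "(\<lambda>i. (1 - u) * g i + u * h i) = G ((1 - u) *\<^sub>R y + u *\<^sub>R z, (1 - u) * r + u * s)"
      unfolding g h G_def
      by (auto simp: fun_eq_iff algebra_simps bilinear_radd[OF bil] bilinear_rsub[OF bil] bilinear_rmul[OF bil] split: option.split)
    then show "(\<lambda>i. (1 - u) * g i + u * h i) \<in> G ` {(y, r). F y \<le> ereal r}"
      using convex_funD[OF conv g(2) h(2) u] by auto
  next
    fix g assume "g \<in> G ` {(y, r). F y \<le> ereal r}"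
    then obtain y r where g: "g = G (y, r)" "F y \<le> ereal r" by auto
    show "\<exists>i\<in>insert None (Some ` I). min \<epsilon> (b - a) \<le> \<bar>g i\<bar>"
    proof (cases "\<forall>p\<in>I. \<bar>B p y - B p x\<bar> < \<epsilon>")
      case True
      then have "ereal b < F y" using box by blast
      also note g(2)
      finally have "b < r" by simp
      then show ?thesis by (auto simp: g G_def)
    next
      case False
      then show ?thesis by (force simp: g G_def bilinear_rsub[OF bil])
    qed
  qed (use I \<open>a < b\<close> in auto)
  then obtain c d where "d > 0"
      and cd: "\<And>y r. F y \<le> ereal r \<Longrightarrow> d \<le> (\<Sum>i\<in>insert None (Some ` I). c i * G (y, r) i)"
    by blast
  define k where "k = c None"
  \<comment> \<open>The separating combination of functionals is again a single \<open>B p\<close>,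
    since \<open>B\<close> is linear in its first argument.\<close>
  define p where "p = (\<Sum>p\<in>I. c (Some p) *\<^sub>R p)"
  have Bp: "B p z = (\<Sum>p\<in>I. c (Some p) * B p z)" for z
    using bil linear_sum[of "\<lambda>q. B q z" "\<lambda>q. c (Some q) *\<^sub>R q" I]
    by (simp add: p_def bilinear_def bilinear_lmul[OF bil])
  have sep: "d \<le> k * (r - a) + B p (y - x)" if "F y \<le> ereal r" for y r
    using cd[OF that] I(1) by (simp add: G_def k_def Bp sum.reindex)
  have "\<exists>p. \<forall>y r. F y \<le> ereal r \<longrightarrow> a + B p (y - x) \<le> r"
  proof (cases "\<exists>y r. F y \<le> ereal r")
    case False
    then show ?thesis by blast
  next
    case True
    then obtain y0 r0 where y0: "F y0 \<le> ereal r0" by blast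
    have "k \<ge> 0"
    proof (rule ccontr)
      assume "\<not> k \<ge> 0"
      \<comment> \<open>The epigraph contains points of arbitrary height over \<open>y0\<close>; at
        this height a negative \<open>k\<close> makes the separated quantity nonpositive.\<close>
      define r where "r = max r0 (a + (B p (y0 - x)) / (-k))"
      have "F y0 \<le> ereal r" using y0 by (auto simp: r_def intro: order_trans)
      from sep[OF this] have "0 < k * (r - a) + B p (y0 - x)" using \<open>d > 0\<close> by linarith
      moreover have "B p (y0 - x) / (-k) \<le> r - a" by (simp add: r_def)
      ultimately show False using \<open>\<not> k \<ge> 0\<close> by (simp add: field_simps)
    qed
    show ?thesis
    proof (cases "k = 0")
      case True
      txt \<open>A vertical hyperplane is tilted by adding a large multiple of it to the given minorant.\<close>
      obtain n where n: "n \<ge> 0" "a \<le> B e x + n * d"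
      proof (rule that[of "\<bar>a - B e x\<bar> / d"])
      qed (use \<open>d > 0\<close> in auto)
      have "a + B (e - n *\<^sub>R p) (y - x) \<le> r" if "F y \<le> ereal r" for y r
      proof -
        have "B e y \<le> r" using le[of y] that by (metis ereal_less_eq(3) order_trans)
        moreover have "n * d \<le> n * B p (y - x)"
          using sep[OF that] True n by (intro mult_left_mono) auto
        ultimately show ?thesis
          using n by (simp add: bilinear_lsub[OF bil] bilinear_lmul[OF bil] bilinear_rsub[OF bil] algebra_simps)
      qed
      then show ?thesis by blast
    next
      case False
      with \<open>k \<ge> 0\<close> have "k > 0" by simp
      have "a + B (- (inverse k) *\<^sub>R p) (y - x) \<le> r" if "F y \<le> ereal r" for y r
      proof -
        have "0 \<le> k * (r - a) + B p (y - x)" using sep[OF that] \<open>d > 0\<close> by linarith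
        then show ?thesis using \<open>k > 0\<close>
          by (simp add: bilinear_lmul[OF bil] bilinear_lneg[OF bil] field_simps)
      qed
      then show ?thesis by blast
    qed
  qed
  then obtain p where p: "\<And>y r. F y \<le> ereal r \<Longrightarrow> a + B p (y - x) \<le> r" by blast
  have "ereal (a + B p (y - x)) \<le> F y" for y
  proof (rule ereal_le_real)
    fix r assume "F y \<le> ereal r"
    from p[OF this] show "ereal (a + B p (y - x)) \<le> ereal r" by simp
  qed
  then show ?thesis by blast
qed

text \<open>A tube argument: the two limits at infinity dispose of all \<open>s\<close> outside
  \<open>{- N2..N1}\<close>, and finitely many local neighbourhoods cover this compact
  interval.\<close>

lemma eventually_all_real:
  fixes Q :: "'z \<Rightarrow> real \<Rightarrow> bool"
  assumes loc: "\<And>t. eventually (\<lambda>(z, s). Q z s) (F \<times>\<^sub>F nhds t)"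
    and top: "eventually (\<lambda>(z, s). Q z s) (F \<times>\<^sub>F at_top)"
    and bot: "eventually (\<lambda>(z, s). Q z (- s)) (F \<times>\<^sub>F at_top)"
  shows "eventually (\<lambda>z. \<forall>s. Q z s) F"
proof -
  obtain P1 N1 where 1: "eventually P1 F" "\<And>z s. P1 z \<Longrightarrow> N1 \<le> s \<Longrightarrow> Q z s"
    using top by (simp add: eventually_prod_filter eventually_at_top_linorder) blast
  obtain P2 N2 where 2: "eventually P2 F" "\<And>z s. P2 z \<Longrightarrow> N2 \<le> s \<Longrightarrow> Q z (- s)"
    using bot by (simp add: eventually_prod_filter eventually_at_top_linorder) blast
  have "\<exists>Pt U. eventually Pt F \<and> open U \<and> t \<in> U \<and> (\<forall>z s. Pt z \<longrightarrow> s \<in> U \<longrightarrow> Q z s)" for t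
  proof -
    obtain Pf Pg where "eventually Pf F" "eventually Pg (nhds t)" "\<And>z s. Pf z \<Longrightarrow> Pg s \<Longrightarrow> Q z s"
      using loc[of t] by (auto simp: eventually_prod_filter)
    then show ?thesis by (intro exI[of _ Pf]) (auto simp: eventually_nhds)
  qed
  then have "\<exists>Pt. \<forall>t. \<exists>U. eventually (Pt t) F \<and> open U \<and> t \<in> U \<and> (\<forall>z s. Pt t z \<longrightarrow> s \<in> U \<longrightarrow> Q z s)"
    by (intro choice allI)
  then obtain Pt where "\<forall>t. \<exists>U. eventually (Pt t) F \<and> open U \<and> t \<in> U \<and> (\<forall>z s. Pt t z \<longrightarrow> s \<in> U \<longrightarrow> Q z s)"
    by (elim exE)
  then have "\<exists>U. \<forall>t. eventually (Pt t) F \<and> open (U t) \<and> t \<in> U t \<and> (\<forall>z s. Pt t z \<longrightarrow> s \<in> U t \<longrightarrow> Q z s)"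
    by (rule choice)
  then obtain U where Pt: "\<And>t. eventually (Pt t) F" and U: "\<And>t. open (U t)" "\<And>t::real. t \<in> U t"
      and Q: "\<And>t z s. Pt t z \<Longrightarrow> s \<in> U t \<Longrightarrow> Q z s"
    by blast
  obtain C where C: "finite C" "{- N2..N1} \<subseteq> (\<Union>t\<in>C. U t)"
  proof (rule compactE_image[of "{- N2..N1}" UNIV U])
    show "{- N2..N1} \<subseteq> (\<Union>t. U t)" using U(2) by blast
  qed (use U(1) in simp_all)
  have "eventually (\<lambda>z. \<forall>t\<in>C. Pt t z) F"
    using C(1) Pt by (simp add: eventually_ball_finite)
  with 1(1) 2(1) show ?thesis
  proof eventually_elim
    case (elim z)
    show ?case
    proof
      fix s
      consider "N1 \<le> s" | "N2 \<le> - s" | "s \<in> {- N2..N1}" by fastforce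
      then show "Q z s"
      proof cases
        case 2
        then show ?thesis using \<open>\<And>z s. P2 z \<Longrightarrow> N2 \<le> s \<Longrightarrow> Q z (- s)\<close>[of z "- s"] elim by simp
      next
        case 3
        then show ?thesis using C(2) Q elim by blast
      qed (use 1 elim in auto)
    qed
  qed
qed

section \<open>Translation infima of disutilities\<close>

text \<open>The vectors \<open>e\<close> and \<open>u\<close> stand for the constant function 1 in
  the two paired spaces: \<open>B e\<close> is the expectation and multiples of \<open>u\<close> are
  the deterministic amounts. The analysis of \<open>R\<close> is thereby free of measure
  theory.\<close>

locale disutility =
  fixes B :: "'l::real_vector \<Rightarrow> 'm::real_vector \<Rightarrow> real" and V :: "'m \<Rightarrow> ereal"
    and e :: 'l and u :: 'm
  assumes bil: "bilinear B" and conv: "convex_fun V"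
    and lsc: "\<And>a x. ereal a < V x \<Longrightarrow> eventually (\<lambda>y. ereal a < V y) (weak_nhds B x)"
    and zero: "V 0 = 0"
    and ge: "\<And>x. ereal (B e x) \<le> V x"
    and strict: "\<And>c. c \<noteq> 0 \<Longrightarrow> ereal c < V (c *\<^sub>R u)"
    and unit: "B e u = 1"
begin

lemmas bil_simps = bilinear_radd[OF bil] bilinear_rsub[OF bil] bilinear_rmul[OF bil] bilinear_rneg[OF bil]
  bilinear_rzero[OF bil]

definition R :: "'m \<Rightarrow> ereal" where
  "R x = (INF t. ereal t + V (x - t *\<^sub>R u))"

section \<open>Semicontinuity and recession along \<open>u\<close>\<close>

lemma shift_less_iff: "ereal a < ereal t + v \<longleftrightarrow> ereal (a - t) < v"
  by (cases v) auto

lemma shift_le_iff: "ereal t + v \<le> ereal a \<longleftrightarrow> v \<le> ereal (a - t)"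
  by (cases v) auto

text \<open>The strict hypograph of \<open>V\<close> is open in point and threshold jointly: a value
  \<open>c\<close> between \<open>a\<close> and \<open>V x\<close> separates the two.\<close>

lemma lsc_epi:
  assumes "ereal a < V x"
  shows "eventually (\<lambda>(y, b). ereal b < V y) (weak_nhds B x \<times>\<^sub>F nhds a)"
proof -
  obtain c where c: "a < c" "ereal c < V x"
    using ereal_dense2[OF assms] by auto
  have "eventually (\<lambda>b. b < c) (nhds a)"
    using c(1) by (intro eventually_nhds_in_open[of "{..<c}", simplified]) auto
  from eventually_prodI[OF lsc[OF c(2)] this] show ?thesis
    by eventually_elim (auto intro: less_trans[where y = "ereal c"])
qed

lemma lsc_epi_compose:
  assumes "ereal a < V x" "\<And>p. ((\<lambda>z. B p (f z)) \<longlongrightarrow> B p x) F" "(g \<longlongrightarrow> a) F"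
  shows "eventually (\<lambda>z. ereal (g z) < V (f z)) F"
proof -
  have "filterlim (\<lambda>z. (f z, g z)) (weak_nhds B x \<times>\<^sub>F nhds a) F"
    using assms(2,3) by (intro filterlim_Pair) (simp_all add: filterlim_weak_nhds)
  from filterlim_iff[THEN iffD1, OF this, rule_format, OF lsc_epi[OF assms(1)]]
  show ?thesis by simp
qed

text \<open>If the inequality failed, convexity with weight \<open>inverse s\<close> between 0,
  where \<open>V\<close> vanishes, and \<open>f z + (c * s) *\<^sub>R u\<close> would give \<open>V
  (inverse s *\<^sub>R f z + c *\<^sub>R u) \<le> inverse s * g z + c\<close>. As \<open>s\<close>
  grows, the argument tends weakly to \<open>c *\<^sub>R u\<close> and the right side to
  \<open>c\<close>, against \<open>strict\<close> and semicontinuity.\<close>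

lemma recession:
  assumes "c \<noteq> 0" and X: "\<And>p. ((\<lambda>z. B p (f z)) \<longlongrightarrow> B p x) F" and g: "(g \<longlongrightarrow> a) F"
  shows "eventually (\<lambda>(z, s). ereal (g z + c * s) < V (f z + (c * s) *\<^sub>R u)) (F \<times>\<^sub>F at_top)"
proof -
  have inv: "((\<lambda>w. inverse (snd w)) \<longlongrightarrow> 0) (F \<times>\<^sub>F (at_top :: real filter))"
    by (rule filterlim_compose[OF tendsto_inverse_0_at_top filterlim_snd]) (rule filterlim_ident)
  have pos: "eventually (\<lambda>w. snd w \<ge> 1) (F \<times>\<^sub>F (at_top :: real filter))"
    using filterlim_snd[of "at_top :: real filter" F] by (auto simp: filterlim_at_top)
  have "eventually (\<lambda>w. ereal (inverse (snd w) * g (fst w) + c)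
      < V (inverse (snd w) *\<^sub>R f (fst w) + c *\<^sub>R u)) (F \<times>\<^sub>F at_top)"
  proof (rule lsc_epi_compose[OF strict[OF \<open>c \<noteq> 0\<close>]])
    have "((\<lambda>w. inverse (snd w) * B p (f (fst w)) + c * B p u) \<longlongrightarrow> 0 * B p x + c * B p u) (F \<times>\<^sub>F at_top)" for p
      by (intro tendsto_intros inv filterlim_compose[OF X filterlim_fst])
    then show "((\<lambda>w. B p (inverse (snd w) *\<^sub>R f (fst w) + c *\<^sub>R u)) \<longlongrightarrow> B p (c *\<^sub>R u)) (F \<times>\<^sub>F at_top)" for p
      by (simp add: bil_simps)
    have "((\<lambda>w. inverse (snd w) * g (fst w) + c) \<longlongrightarrow> 0 * a + c) (F \<times>\<^sub>F at_top)"
      by (intro tendsto_intros inv filterlim_compose[OF g filterlim_fst])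
    then show "((\<lambda>w. inverse (snd w) * g (fst w) + c) \<longlongrightarrow> c) (F \<times>\<^sub>F at_top)" by simp
  qed
  with pos show ?thesis
  proof eventually_elim
    case (elim w)
    obtain z s where w: "w = (z, s)" by force
    have "s \<ge> 1" using elim w by simp
    have "ereal (g z + c * s) < V (f z + (c * s) *\<^sub>R u)"
    proof (rule ccontr)
      assume "\<not> ?thesis"
      then have "V (f z + (c * s) *\<^sub>R u) \<le> ereal (g z + c * s)" by simp
      moreover have "V 0 \<le> ereal 0" by (simp add: zero)
      ultimately have "V ((1 - inverse s) *\<^sub>R 0 + inverse s *\<^sub>R (f z + (c * s) *\<^sub>R u))
          \<le> ereal ((1 - inverse s) * 0 + inverse s * (g z + c * s))"
        using \<open>s \<ge> 1\<close> by (intro convex_funD[OF conv]) (auto simp: field_simps)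
      moreover have "inverse s * (g z + c * s) = inverse s * g z + c"
        "inverse s *\<^sub>R (f z + (c * s) *\<^sub>R u) = inverse s *\<^sub>R f z + c *\<^sub>R u"
        using \<open>s \<ge> 1\<close> by (simp_all add: algebra_simps)
      ultimately show False using elim w by simp
    qed
    then show ?case by (simp add: w)
  qed
qed

text \<open>The threshold \<open>b\<close> varies together with the point \<open>y\<close>, so that one statement yields a strict gap
  at \<open>x\<close> (attainment) and a bound near \<open>x\<close> (semicontinuity).\<close>

lemma eventually_all_shifts:
  assumes "\<And>t. ereal a < ereal t + V (x - t *\<^sub>R u)"
  shows "eventually (\<lambda>(y, b). \<forall>t. ereal b < ereal t + V (y - t *\<^sub>R u)) (weak_nhds B x \<times>\<^sub>F nhds a)"
proof -
  define F where "F = weak_nhds B x \<times>\<^sub>F nhds a"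
  have f: "((\<lambda>z. B p (fst z)) \<longlongrightarrow> B p x) F" for p
    unfolding F_def by (intro filterlim_compose[OF tendsto_weak_nhds filterlim_fst])
  have g: "(snd \<longlongrightarrow> a) F"
    unfolding F_def by (rule filterlim_snd)
  have "eventually (\<lambda>z. \<forall>t. ereal (snd z) < ereal t + V (fst z - t *\<^sub>R u)) F"
    unfolding shift_less_iff
  proof (rule eventually_all_real)
    fix t :: real
    have "eventually (\<lambda>w. ereal (snd (fst w) - snd w) < V (fst (fst w) - snd w *\<^sub>R u)) (F \<times>\<^sub>F nhds t)"
    proof (rule lsc_epi_compose)
      show "ereal (a - t) < V (x - t *\<^sub>R u)"
        using assms[of t] by (simp add: shift_less_iff)
      have "((\<lambda>w. B p (fst (fst w)) - snd w * B p u) \<longlongrightarrow> B p x - t * B p u) (F \<times>\<^sub>F nhds t)" for p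
        by (intro tendsto_intros filterlim_compose[OF f filterlim_fst] filterlim_snd)
      then show "((\<lambda>w. B p (fst (fst w) - snd w *\<^sub>R u)) \<longlongrightarrow> B p (x - t *\<^sub>R u)) (F \<times>\<^sub>F nhds t)" for p
        by (simp add: bil_simps)
      show "((\<lambda>w. snd (fst w) - snd w) \<longlongrightarrow> a - t) (F \<times>\<^sub>F nhds t)"
        by (intro tendsto_intros filterlim_compose[OF g filterlim_fst] filterlim_snd)
    qed
    then show "eventually (\<lambda>(z, s). ereal (snd z - s) < V (fst z - s *\<^sub>R u)) (F \<times>\<^sub>F nhds t)"
      by (simp add: case_prod_unfold)
  next
    \<comment> \<open>Shifts by \<open>s\<close> recede in direction \<open>- u\<close>, shifts by
      \<open>- s\<close> in direction \<open>u\<close>; hence the choices -1 and 1 for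
      \<open>c\<close>.\<close>
    show "eventually (\<lambda>(z, s). ereal (snd z - s) < V (fst z - s *\<^sub>R u)) (F \<times>\<^sub>F at_top)"
      using recession[of "-1" fst x F snd a] f g by simp
    show "eventually (\<lambda>(z, s). ereal (snd z - - s) < V (fst z - (- s) *\<^sub>R u)) (F \<times>\<^sub>F at_top)"
      using recession[of 1 fst x F snd a] f g by simp
  qed
  then show ?thesis by (simp add: F_def case_prod_unfold)
qed

text \<open>The good thresholds form a neighbourhood of \<open>a\<close>, so some of them exceed
  \<open>a\<close>; strict inequalities for the single shifts thus become a uniform gap.\<close>

lemma R_locally_bounded_below:
  assumes "\<And>t. ereal a < ereal t + V (x - t *\<^sub>R u)"
  obtains b where "a < b" "eventually (\<lambda>y. ereal b \<le> R y) (weak_nhds B x)"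
proof -
  obtain Q1 Q2 where Q: "eventually Q1 (weak_nhds B x)" "eventually Q2 (nhds a)"
      "\<And>y b. Q1 y \<Longrightarrow> Q2 b \<Longrightarrow> \<forall>t. ereal b < ereal t + V (y - t *\<^sub>R u)"
    using eventually_all_shifts[OF assms] by (simp add: eventually_prod_filter) blast
  have "eventually Q2 (at_right a)"
    using Q(2) by (simp add: eventually_nhds_conv_at eventually_at_split)
  then obtain c where "a < c" "\<And>b. a < b \<Longrightarrow> b < c \<Longrightarrow> Q2 b"
    by (auto simp: eventually_at_right_field)
  moreover obtain b where "a < b" "b < c" using dense[OF \<open>a < c\<close>] by blast
  ultimately have "Q2 b" by blast
  have "eventually (\<lambda>y. ereal b \<le> R y) (weak_nhds B x)"
    using Q(1)
  proof eventually_elim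
    case (elim y)
    show ?case
      unfolding R_def using Q(3)[OF elim \<open>Q2 b\<close>] by (intro INF_greatest) (simp add: less_imp_le)
  qed
  with \<open>a < b\<close> show ?thesis by (rule that)
qed

section \<open>Attainment, convexity and affine minorants of \<open>R\<close>\<close>

lemma R_le: "R x \<le> ereal t + V (x - t *\<^sub>R u)"
  unfolding R_def by (rule INF_lower) simp

lemma R_ge: "ereal (B e x) \<le> R x"
  unfolding R_def
proof (rule INF_greatest)
  fix t
  show "ereal (B e x) \<le> ereal t + V (x - t *\<^sub>R u)"
    using add_left_mono[OF ge[of "x - t *\<^sub>R u"], of "ereal t"] by (simp add: bil_simps unit)
qed

text \<open>If no shift attained a finite value \<open>R x\<close>, it would lie strictly below all
  shift values, and the gap lemma would place \<open>R x\<close> strictly above itself.\<close>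

lemma R_attained: "\<exists>t. R x = ereal t + V (x - t *\<^sub>R u)"
proof (cases "R x")
  case (real a)
  show ?thesis
  proof (rule ccontr)
    assume "\<not> ?thesis"
    then have "ereal a < ereal t + V (x - t *\<^sub>R u)" for t
      using R_le[of x t] real by (metis order_le_less)
    then obtain b where "a < b" "eventually (\<lambda>y. ereal b \<le> R y) (weak_nhds B x)"
      by (rule R_locally_bounded_below)
    from eventually_weak_nhds_imp[OF this(2)] \<open>a < b\<close> real show False by simp
  qed
next
  case PInf
  then show ?thesis using R_le[of x 0] by (intro exI[of _ 0]) simp
next
  case MInf
  then show ?thesis using R_ge[of x] by simp
qed

text \<open>Partial minimisation preserves convexity; optimal shifts \<open>t\<close> and
  \<open>t'\<close> combine to the shift \<open>k * t + l * t'\<close>.\<close>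

lemma convex_R: "convex_fun R"
  unfolding convex_fun_def
proof (rule convexI)
  fix z w and k l :: real
  assume z: "z \<in> {(x, r). R x \<le> ereal r}" and w: "w \<in> {(x, r). R x \<le> ereal r}"
    and kl: "0 \<le> k" "0 \<le> l" "k + l = 1"
  obtain x r where z': "z = (x, r)" by force
  obtain y s where w': "w = (y, s)" by force
  obtain t where t: "V (x - t *\<^sub>R u) \<le> ereal (r - t)"
    using R_attained[of x] z z' by (auto simp: shift_le_iff)
  obtain t' where t': "V (y - t' *\<^sub>R u) \<le> ereal (s - t')"
    using R_attained[of y] w w' by (auto simp: shift_le_iff)
  have k: "k = 1 - l" using kl by simp
  have "V ((1 - l) *\<^sub>R (x - t *\<^sub>R u) + l *\<^sub>R (y - t' *\<^sub>R u)) \<le> ereal ((1 - l) * (r - t) + l * (s - t'))"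
    using kl by (intro convex_funD[OF conv t t']) auto
  also have "(1 - l) *\<^sub>R (x - t *\<^sub>R u) + l *\<^sub>R (y - t' *\<^sub>R u) = (k *\<^sub>R x + l *\<^sub>R y) - (k * t + l * t') *\<^sub>R u"
    unfolding k by (simp add: algebra_simps)
  also have "(1 - l) * (r - t) + l * (s - t') = (k * r + l * s) - (k * t + l * t')"
    unfolding k by (simp add: algebra_simps)
  finally have "R (k *\<^sub>R x + l *\<^sub>R y) \<le> ereal (k * r + l * s)"
    unfolding shift_le_iff[symmetric] using R_le order_trans by blast
  then show "k *\<^sub>R z + l *\<^sub>R w \<in> {(x, r). R x \<le> ereal r}" by (simp add: z' w')
qed

lemma R_minorant:
  assumes "ereal a < R x"
  obtains p where "\<And>y. ereal (a + B p (y - x)) \<le> R y"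
proof -
  have "ereal a < ereal t + V (x - t *\<^sub>R u)" for t
    using assms R_le[of x t] by (rule less_le_trans)
  then obtain b where b: "a < b" "eventually (\<lambda>y. ereal b \<le> R y) (weak_nhds B x)"
    by (rule R_locally_bounded_below)
  obtain c where "a < c" "c < b" using dense[OF b(1)] by blast
  have "eventually (\<lambda>y. ereal c < R y) (weak_nhds B x)"
    using b(2) by eventually_elim (use \<open>c < b\<close> in \<open>simp add: less_le_trans[of "ereal c" "ereal b"]\<close>)
  from affine_minorant[OF bil convex_R R_ge this \<open>a < c\<close>] show ?thesis using that by blast
qed

text \<open>A minorant of \<open>R\<close> is a minorant of \<open>V\<close> after every shift. The
  constant \<open>B p x - a\<close> is the bound that this places on the conjugate of
  \<open>V\<close> at \<open>p\<close>.\<close>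

lemma minorant_iff:
  "(\<forall>y. ereal (a + B p (y - x)) \<le> R y) \<longleftrightarrow> B p u = 1 \<and> (\<forall>y. ereal (B p y - (B p x - a)) \<le> V y)"
proof
  assume L: "\<forall>y. ereal (a + B p (y - x)) \<le> R y"
  have le: "ereal (a + B p (y + t *\<^sub>R u - x) - t) \<le> V y" for y t
  proof -
    have "ereal (a + B p (y + t *\<^sub>R u - x)) \<le> ereal t + V y"
      using L R_le[of "y + t *\<^sub>R u" t] by (auto intro: order_trans)
    then show ?thesis by (cases "V y") auto
  qed
  \<comment> \<open>At \<open>y = 0\<close> a linear function of \<open>t\<close> is bounded above
    on the whole line, so its slope must vanish.\<close>
  have bd: "t * (B p u - 1) \<le> B p x - a" for t
    using le[of 0 t] by (simp add: zero bil_simps algebra_simps)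
  have "B p u = 1"
  proof (rule ccontr)
    assume "B p u \<noteq> 1"
    then show False using bd[of "(B p x - a + 1) / (B p u - 1)"] by simp
  qed
  moreover have "ereal (B p y - (B p x - a)) \<le> V y" for y
    using le[of y 0] by (simp add: bil_simps algebra_simps)
  ultimately show "B p u = 1 \<and> (\<forall>y. ereal (B p y - (B p x - a)) \<le> V y)" by blast
next
  assume "B p u = 1 \<and> (\<forall>y. ereal (B p y - (B p x - a)) \<le> V y)"
  then have 1: "B p u = 1" and le: "\<And>y. ereal (B p y - (B p x - a)) \<le> V y" by auto
  show "\<forall>y. ereal (a + B p (y - x)) \<le> R y"
  proof
    fix y
    show "ereal (a + B p (y - x)) \<le> R y"
      unfolding R_def
    proof (rule INF_greatest)
      fix t
      have "ereal t + ereal (B p (y - t *\<^sub>R u) - (B p x - a)) \<le> ereal t + V (y - t *\<^sub>R u)"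
        by (intro add_left_mono le)
      then show "ereal (a + B p (y - x)) \<le> ereal t + V (y - t *\<^sub>R u)"
        by (simp add: bil_simps 1 algebra_simps)
    qed
  qed
qed

end

section \<open>Duality for generalised variational inference\<close>

text \<open>The pay-off function is only a.s. equal to a measurable function, and \<open>integral_cong_AE\<close> needs
  both integrands to be measurable.\<close>

lemma (in complete_measure) borel_measurable_AE_eq:
  assumes g: "g \<in> borel_measurable M" and ae: "AE x in M. g x = f x"
  shows "f \<in> borel_measurable M"
proof (rule measurableI)
  fix A :: "'b set" assume "A \<in> sets borel"
  obtain N where N: "{x\<in>space M. g x \<noteq> f x} \<subseteq> N" "N \<in> null_sets M"
    using ae by (auto elim!: AE_E)
  have "f -` A \<inter> space M = (g -` A \<inter> space M - N) \<union> (N \<inter> (f -` A \<inter> space M))"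
    using N(1) by auto
  moreover have "N \<inter> (f -` A \<inter> space M) \<in> sets M"
    using N(2) by (intro complete[of _ N]) auto
  ultimately show "f -` A \<inter> space M \<in> sets M"
    using measurable_sets[OF g \<open>A \<in> sets borel\<close>] N(2) by (metis null_setsD2 sets.Diff sets.Un)
qed simp

section \<open>Almost sure classes and their representatives\<close>

lemma class_of_eq:
  assumes "function_space P \<iota>" "AE \<theta> in P. \<iota> x \<theta> = f \<theta>"
  shows "class_of P \<iota> f = x"
  unfolding class_of_def
proof (rule the_equality)
  fix y assume "AE \<theta> in P. \<iota> y \<theta> = f \<theta>"
  with assms(2) have "AE \<theta> in P. \<iota> y \<theta> = \<iota> x \<theta>" by eventually_elim simp
  then show "y = x" using assms(1) by (auto simp: function_space_def)
qed (rule assms(2))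

lemma class_of_AE:
  assumes "function_space P \<iota>" "in_space P \<iota> f"
  shows "AE \<theta> in P. \<iota> (class_of P \<iota> f) \<theta> = f \<theta>"
  using assms class_of_eq unfolding in_space_def by metis

lemma in_space_simple:
  assumes "function_space P \<iota>" "simple_function P f"
  shows "in_space P \<iota> f"
  using assms by (simp add: function_space_def in_space_def)

lemma class_of_const:
  assumes "function_space P \<iota>"
  shows "class_of P \<iota> (\<lambda>_. t) = t *\<^sub>R class_of P \<iota> (\<lambda>_. 1)"
proof (rule class_of_eq[OF assms])
  have "AE \<theta> in P. \<iota> (t *\<^sub>R class_of P \<iota> (\<lambda>_. 1)) \<theta> = t * \<iota> (class_of P \<iota> (\<lambda>_. 1)) \<theta>"
    using assms by (simp add: function_space_def)
  with class_of_AE[OF assms in_space_simple[OF assms simple_function_const[of _ 1]]]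
  show "AE \<theta> in P. \<iota> (t *\<^sub>R class_of P \<iota> (\<lambda>_. 1)) \<theta> = t"
    by eventually_elim simp
qed

locale risk_duality = prob_space P + complete_measure P for P :: "'a measure" +
  fixes \<iota>L :: "'l::banach \<Rightarrow> 'a \<Rightarrow> real" and \<iota>M :: "'m::banach \<Rightarrow> 'a \<Rightarrow> real"
    and V :: "'m \<Rightarrow> ereal"
  assumes paired: "paired_spaces P \<iota>L \<iota>M"
    and disutility: "risk_averse_disutility P \<iota>L \<iota>M V"
begin

abbreviation "B \<equiv> pairing P \<iota>L \<iota>M"
abbreviation "clL \<equiv> class_of P \<iota>L"
abbreviation "clM \<equiv> class_of P \<iota>M"

lemma fs: "function_space P \<iota>L" "function_space P \<iota>M"
  using paired by (auto simp: paired_spaces_def)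

lemma meas [measurable]: "\<iota>L p \<in> borel_measurable P" "\<iota>M X \<in> borel_measurable P"
  using fs by (auto simp: function_space_def)

lemma pairing_bounded_linear: "bounded_linear (B p)"
  using paired by (simp add: paired_spaces_def)

lemma bilinear_pairing: "bilinear B"
  using paired by (simp add: bilinear_def paired_spaces_def bounded_linear.linear)

lemma pairing_cong:
  assumes "AE \<theta> in P. \<iota>L p \<theta> = q \<theta>" "AE \<theta> in P. \<iota>M X \<theta> = f \<theta>"
  shows "B p X = (\<integral>\<theta>. q \<theta> * f \<theta> \<partial>P)"
  unfolding pairing_def
proof (rule integral_cong_AE)
  have [measurable]: "q \<in> borel_measurable P" "f \<in> borel_measurable P"
    using assms by (auto intro: borel_measurable_AE_eq meas)
  show "(\<lambda>\<theta>. q \<theta> * f \<theta>) \<in> borel_measurable P" by measurable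
  show "AE \<theta> in P. \<iota>L p \<theta> * \<iota>M X \<theta> = q \<theta> * f \<theta>"
    using assms by eventually_elim simp
qed measurable

lemma const_AE:
  "AE \<theta> in P. \<iota>L (clL (\<lambda>_. t)) \<theta> = t" "AE \<theta> in P. \<iota>M (clM (\<lambda>_. t)) \<theta> = t"
  by (auto intro!: class_of_AE fs in_space_simple simple_function_const)

lemma pairing_one_left: "B (clL (\<lambda>_. 1)) X = (\<integral>\<theta>. \<iota>M X \<theta> \<partial>P)"
  using pairing_cong[OF const_AE(1) AE_I2[of P "\<lambda>\<theta>. \<iota>M X \<theta> = \<iota>M X \<theta>"]] by simp

lemma pairing_one_right: "B p (clM (\<lambda>_. 1)) = (\<integral>\<theta>. \<iota>L p \<theta> \<partial>P)"
  using pairing_cong[OF AE_I2[of P "\<lambda>\<theta>. \<iota>L p \<theta> = \<iota>L p \<theta>"] const_AE(2)] by simp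

lemma pairing_one_one: "B (clL (\<lambda>_. 1)) (clM (\<lambda>_. 1)) = 1"
  using pairing_cong[OF const_AE] by (simp add: prob_space)

lemma V_ge: "ereal (B (clL (\<lambda>_. 1)) X) \<le> V X"
  and V_eq_iff: "V X = ereal (B (clL (\<lambda>_. 1)) X) \<longleftrightarrow> X = 0"
  and V_mono: "(AE \<theta> in P. \<iota>M X \<theta> \<le> \<iota>M X' \<theta>) \<Longrightarrow> V X \<le> V X'"
  using disutility unfolding risk_averse_disutility_def pairing_one_left by blast+

sublocale disutility B V "clL (\<lambda>_. 1)" "clM (\<lambda>_. 1)"
proof
  show "bilinear B" by (rule bilinear_pairing)
  show "convex_fun V" using disutility by (simp add: risk_averse_disutility_def)
  show "eventually (\<lambda>y. ereal a < V y) (weak_nhds B x)" if "ereal a < V x" for a x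
    using disutility that by (intro lsc_in_weak_topology) (auto simp: risk_averse_disutility_def)
  show "V 0 = 0" using V_eq_iff[of 0] bilinear_rzero[OF bilinear_pairing] by (simp add: zero_ereal_def)
  show "ereal (B (clL (\<lambda>_. 1)) x) \<le> V x" for x by (rule V_ge)
  show "B (clL (\<lambda>_. 1)) (clM (\<lambda>_. 1)) = 1" by (rule pairing_one_one)
  \<comment> \<open>Equality in \<open>V_ge\<close> occurs only at 0, and a constant
    \<open>c\<close> with expectation \<open>c \<noteq> 0\<close> is not 0.\<close>
  show "ereal c < V (c *\<^sub>R clM (\<lambda>_. 1))" if "c \<noteq> 0" for c
  proof -
    have c: "B (clL (\<lambda>_. 1)) (c *\<^sub>R clM (\<lambda>_. 1)) = c"
      by (simp add: bilinear_rmul[OF bilinear_pairing] pairing_one_one)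
    then have "c *\<^sub>R clM (\<lambda>_. 1) \<noteq> 0"
      using that bilinear_rzero[OF bilinear_pairing] by metis
    then show ?thesis
      using V_ge[of "c *\<^sub>R clM (\<lambda>_. 1)"] V_eq_iff[of "c *\<^sub>R clM (\<lambda>_. 1)"] c by (simp add: order_less_le)
  qed
qed

lemma risk_eq: "risk P \<iota>M V = R"
  by (simp add: fun_eq_iff risk_def R_def class_of_const[OF fs(2), symmetric])

text \<open>Subtracting \<open>V X\<close> can be undone since \<open>V_ge\<close> excludes minus
  infinity. With \<open>c = B p x - a\<close> the right side is the condition on \<open>V\<close> in
  \<open>minorant_iff\<close>.\<close>

lemma conj_le_iff:
  "conj_disutility P \<iota>L \<iota>M V p \<le> ereal c \<longleftrightarrow> (\<forall>X. ereal (B p X - c) \<le> V X)"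
proof -
  have "ereal (B p X) - V X \<le> ereal c \<longleftrightarrow> ereal (B p X - c) \<le> V X" for X
    using V_ge[of X] by (cases "V X") auto
  then show ?thesis by (simp add: conj_disutility_def SUP_le_iff)
qed

text \<open>Tested with \<open>X = 0\<close>. This keeps the GVI objective away from plus
  infinity.\<close>

lemma conj_nonneg: "0 \<le> conj_disutility P \<iota>L \<iota>M V p"
  unfolding conj_disutility_def
  by (rule SUP_upper2[of 0]) (simp_all add: bil_simps zero)

text \<open>Monotonicity of the disutility forces nonnegativity: otherwise large negative multiples of
  the indicator of the event where the dual element is negative violate the minorant.\<close>

lemma minorant_nonneg:
  assumes le: "\<And>X. ereal (B p X - c) \<le> V X"
  shows "AE \<theta> in P. 0 \<le> \<iota>L p \<theta>"
proof -
  define A where "A = {\<theta> \<in> space P. \<iota>L p \<theta> < 0}"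
  have A [measurable]: "A \<in> sets P" unfolding A_def by measurable
  define X where "X = clM (indicator A)"
  have X: "AE \<theta> in P. \<iota>M X \<theta> = indicator A \<theta>"
    unfolding X_def using A by (intro class_of_AE fs in_space_simple simple_function_indicator)
  have "- s * B p X \<le> c" if "s \<ge> 0" for s
  proof -
    have "AE \<theta> in P. \<iota>M ((- s) *\<^sub>R X) \<theta> = - s * \<iota>M X \<theta>"
      using fs(2) unfolding function_space_def by blast
    moreover have "AE \<theta> in P. \<iota>M (0 *\<^sub>R X) \<theta> = 0 * \<iota>M X \<theta>"
      using fs(2) unfolding function_space_def by blast
    ultimately have "AE \<theta> in P. \<iota>M ((- s) *\<^sub>R X) \<theta> \<le> \<iota>M 0 \<theta>"
      using X by eventually_elim (use \<open>s \<ge> 0\<close> in simp)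
    then have "V ((- s) *\<^sub>R X) \<le> ereal 0"
      using V_mono zero by (metis zero_ereal_def)
    with le[of "(- s) *\<^sub>R X"] have "ereal (B p ((- s) *\<^sub>R X) - c) \<le> ereal 0"
      by (rule order_trans)
    then show ?thesis by (simp add: bil_simps)
  qed
  \<comment> \<open>A negative \<open>B p X\<close> would let the bounded quantity grow without
    limit in \<open>s\<close>; the chosen \<open>s\<close> gives it the value
    \<open>\<bar>c\<bar> + 1\<close>.\<close>
  have "0 \<le> B p X"
  proof (rule ccontr)
    assume "\<not> 0 \<le> B p X"
    then have "\<bar>c\<bar> + 1 \<le> c"
      using \<open>\<And>s. s \<ge> 0 \<Longrightarrow> - s * B p X \<le> c\<close>[of "(\<bar>c\<bar> + 1) / - B p X"] by (simp add: divide_nonneg_neg)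
    then show False by simp
  qed
  \<comment> \<open>This is the negative part of \<open>\<iota>L p\<close>; its integral is both
    nonnegative and nonpositive.\<close>
  define h where "h \<theta> = - (\<iota>L p \<theta> * indicator A \<theta>)" for \<theta>
  have BX: "B p X = (\<integral>\<theta>. \<iota>L p \<theta> * indicator A \<theta> \<partial>P)"
    by (rule pairing_cong[OF _ X]) simp
  have "integrable P (\<lambda>\<theta>. \<iota>L p \<theta> * indicator A \<theta>)"
  proof (rule integrable_cong_AE_imp[of P "\<lambda>\<theta>. \<iota>L p \<theta> * \<iota>M X \<theta>"])
    show "integrable P (\<lambda>\<theta>. \<iota>L p \<theta> * \<iota>M X \<theta>)"
      using paired by (simp add: paired_spaces_def)
    show "(\<lambda>\<theta>. \<iota>L p \<theta> * indicator A \<theta>) \<in> borel_measurable P"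
      by (intro borel_measurable_times meas borel_measurable_indicator A)
    show "AE \<theta> in P. \<iota>L p \<theta> * \<iota>M X \<theta> = \<iota>L p \<theta> * indicator A \<theta>"
      using X by eventually_elim simp
  qed
  then have int: "integrable P h" unfolding h_def by simp
  have nn: "0 \<le> h \<theta>" for \<theta>
    by (auto simp: h_def A_def indicator_def)
  have "(\<integral>\<theta>. h \<theta> \<partial>P) = - B p X"
    by (simp add: h_def BX)
  moreover have "0 \<le> (\<integral>\<theta>. h \<theta> \<partial>P)"
    by (intro integral_nonneg_AE AE_I2 nn)
  ultimately have "(\<integral>\<theta>. h \<theta> \<partial>P) = 0"
    using \<open>0 \<le> B p X\<close> by linarith
  then have "AE \<theta> in P. h \<theta> = 0"
    using integral_nonneg_eq_0_iff_AE[OF int] nn by simp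
  then show ?thesis
    using AE_space by eventually_elim (auto simp: h_def A_def indicator_def split: if_splits)
qed

lemma density_of_minorant:
  assumes "\<And>y. ereal (a + B p (y - x)) \<le> R y"
  shows "\<iota>L p \<in> densities P"
  using minorant_iff[of a p x] minorant_nonneg[of p "B p x - a"] assms
  by (auto simp: densities_def pairing_one_right)

section \<open>Optimal densities as subgradients\<close>

context
  fixes \<sigma> :: real and f :: "'a \<Rightarrow> real" and x :: 'm
  assumes \<sigma>: "\<sigma> > 0" and f: "in_space P \<iota>M f"
  defines "x \<equiv> inverse \<sigma> *\<^sub>R clM f"
begin

text \<open>Divided by \<sigma>, the inequality bounds the conjugate by
  \<open>B (clL q) x - a\<close>, and being a density supplies the normalisation in
  \<open>minorant_iff\<close>. A density outside the space has objective minus infinity, so both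
  sides fail.\<close>

lemma objective_ge_iff:
  assumes q: "q \<in> densities P"
  shows "ereal (\<sigma> * a) \<le> gvi_objective P \<iota>L \<iota>M V \<sigma> f q \<longleftrightarrow>
    in_space P \<iota>L q \<and> (\<forall>y. ereal (a + B (clL q) (y - x)) \<le> R y)"
proof (cases "in_space P \<iota>L q")
  case True
  let ?p = "clL q"
  have p: "AE \<theta> in P. \<iota>L ?p \<theta> = q \<theta>" by (rule class_of_AE[OF fs(1) True])
  have "(\<integral>\<theta>. q \<theta> * f \<theta> \<partial>P) = B ?p (clM f)"
    using pairing_cong[OF p class_of_AE[OF fs(2) f]] by simp
  then have int: "(\<integral>\<theta>. q \<theta> * f \<theta> \<partial>P) = \<sigma> * B ?p x"
    using \<sigma> by (simp add: x_def bil_simps)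
  have "B ?p (clM (\<lambda>_. 1)) = (\<integral>\<theta>. q \<theta> * 1 \<partial>P)"
    by (rule pairing_cong[OF p const_AE(2)])
  then have unit: "B ?p (clM (\<lambda>_. 1)) = 1" using q by (simp add: densities_def)
  have "ereal (\<sigma> * a) \<le> gvi_objective P \<iota>L \<iota>M V \<sigma> f q \<longleftrightarrow>
      conj_disutility P \<iota>L \<iota>M V ?p \<le> ereal (B ?p x - a)"
  proof (cases "conj_disutility P \<iota>L \<iota>M V ?p")
    case (real c)
    have "\<sigma> * a \<le> \<sigma> * B ?p x - \<sigma> * c \<longleftrightarrow> \<sigma> * a \<le> \<sigma> * (B ?p x - c)"
      by (simp add: algebra_simps)
    also have "\<dots> \<longleftrightarrow> c \<le> B ?p x - a" using \<sigma> by auto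
    finally show ?thesis using True by (simp add: gvi_objective_def int real)
  qed (use True \<sigma> conj_nonneg[of ?p] in \<open>auto simp: gvi_objective_def int\<close>)
  then show ?thesis
    using True unit by (simp add: conj_le_iff minorant_iff)
qed (simp add: gvi_objective_def)

text \<open>Forward, optimality against the densities from \<open>R_minorant\<close> makes
  \<open>q\<close> induce a minorant at each level below \<open>R x\<close>, and the level tends to
  \<open>R x\<close>. Backward, no minorant induced by a density exceeds \<open>R x\<close> at
  \<open>x\<close>.\<close>

lemma solution_iff:
  assumes q: "q \<in> densities P"
  shows "gvi_solution P \<iota>L \<iota>M V \<sigma> f q \<longleftrightarrow>
    in_space P \<iota>L q \<and> (\<exists>r. R x = ereal r \<and> (\<forall>y. ereal (r + B (clL q) (y - x)) \<le> R y))"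
    (is "_ \<longleftrightarrow> ?rhs")
proof
  assume "gvi_solution P \<iota>L \<iota>M V \<sigma> f q"
  then have max: "gvi_objective P \<iota>L \<iota>M V \<sigma> f q' \<le> gvi_objective P \<iota>L \<iota>M V \<sigma> f q"
    if "q' \<in> densities P" for q'
    using that by (auto simp: gvi_solution_def intro: SUP_upper)
  have below: "in_space P \<iota>L q \<and> (\<forall>y. ereal (a + B (clL q) (y - x)) \<le> R y)" if a: "ereal a < R x" for a
  proof -
    obtain p where p: "\<And>y. ereal (a + B p (y - x)) \<le> R y" using R_minorant[OF a] by blast
    have "clL (\<iota>L p) = p" by (rule class_of_eq[OF fs(1)]) simp
    then have "ereal (\<sigma> * a) \<le> gvi_objective P \<iota>L \<iota>M V \<sigma> f (\<iota>L p)"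
      using p by (subst objective_ge_iff) (auto simp: in_space_def intro: density_of_minorant)
    also have "\<dots> \<le> gvi_objective P \<iota>L \<iota>M V \<sigma> f q"
      by (rule max[OF density_of_minorant[OF p]])
    finally show ?thesis using q by (simp add: objective_ge_iff)
  qed
  have low: "ereal (B (clL (\<lambda>_. 1)) x - 1) < R x"
    using R_ge[of x] by (rule less_le_trans[rotated]) simp
  show ?rhs
  proof (cases "R x")
    case (real r)
    have "ereal (r + B (clL q) (y - x)) \<le> R y" for y
    proof (rule ereal_le_epsilon2)
      fix \<epsilon> :: real assume "0 < \<epsilon>"
      then have "ereal (r - \<epsilon> + B (clL q) (y - x)) \<le> R y"
        using below[of "r - \<epsilon>"] real by simp
      then show "ereal (r + B (clL q) (y - x)) \<le> R y + ereal \<epsilon>"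
        by (cases "R y") auto
    qed
    then show ?thesis using below[OF low] real by blast
  next
    case PInf
    \<comment> \<open>At a level one above \<open>B ?p x\<close> the minorant would give
      \<open>1 \<le> V 0\<close>; thus a solution forces \<open>R x\<close> to be finite.\<close>
    let ?p = "clL q"
    have "ereal (B ?p 0 - (B ?p x - (B ?p x + 1))) \<le> V 0"
      using below[of "B ?p x + 1"] PInf by (simp only: minorant_iff) simp
    then show ?thesis by (simp add: bil_simps zero)
  next
    case MInf
    then show ?thesis using R_ge[of x] by simp
  qed
next
  assume ?rhs
  then obtain r where L: "in_space P \<iota>L q" and r: "R x = ereal r"
    and p: "\<And>y. ereal (r + B (clL q) (y - x)) \<le> R y" by blast
  \<comment> \<open>A larger objective would yield a minorant of \<open>R\<close> whose value
    \<open>c / \<sigma>\<close> at \<open>x\<close> exceeds \<open>R x\<close>.\<close>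
  have "gvi_objective P \<iota>L \<iota>M V \<sigma> f q' \<le> ereal (\<sigma> * r)" if "q' \<in> densities P" for q'
  proof (rule ccontr)
    assume "\<not> ?thesis"
    then obtain c where c: "\<sigma> * r < c" "ereal c < gvi_objective P \<iota>L \<iota>M V \<sigma> f q'"
      using ereal_dense2[of "ereal (\<sigma> * r)"] by (auto simp: not_le)
    then have "ereal (\<sigma> * (c / \<sigma>)) \<le> gvi_objective P \<iota>L \<iota>M V \<sigma> f q'" using \<sigma> by simp
    then have "ereal (c / \<sigma> + B (clL q') (x - x)) \<le> R x"
      using that by (subst (asm) objective_ge_iff) blast+
    then have "c / \<sigma> \<le> r" by (simp add: r bil_simps)
    then show False using c(1) \<sigma> by (simp add: field_simps)
  qed
  moreover have "ereal (\<sigma> * r) \<le> gvi_objective P \<iota>L \<iota>M V \<sigma> f q"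
    using q L p by (simp add: objective_ge_iff)
  ultimately show "gvi_solution P \<iota>L \<iota>M V \<sigma> f q"
    unfolding gvi_solution_def using q
    by (intro conjI antisym SUP_upper SUP_least) (auto intro: order_trans)
qed

lemma dual_of_in_subdifferential_iff:
  "dual_of P \<iota>L \<iota>M p \<in> subdifferential R x \<longleftrightarrow>
    (\<exists>r. R x = ereal r \<and> (\<forall>y. ereal (r + B p (y - x)) \<le> R y))"
proof (cases "R x")
  case (real r)
  have "ereal (B p (y - x)) \<le> R y - ereal r \<longleftrightarrow> ereal (r + B p (y - x)) \<le> R y" for y
    by (cases "R y") auto
  then show ?thesis
    by (simp add: subdifferential_def dual_of_def bounded_linear_Blinfun_apply pairing_bounded_linear real)
qed (auto simp: subdifferential_def)

lemma solution_imp_risk_identifier: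
  assumes "gvi_solution P \<iota>L \<iota>M V \<sigma> f q"
  shows "in_space P \<iota>L q" "dual_of P \<iota>L \<iota>M (clL q) \<in> subdifferential R x"
proof -
  have "q \<in> densities P" using assms by (simp add: gvi_solution_def)
  then show "in_space P \<iota>L q" "dual_of P \<iota>L \<iota>M (clL q) \<in> subdifferential R x"
    using assms by (auto simp: solution_iff dual_of_in_subdifferential_iff)
qed

text \<open>A subgradient in the paired space is automatically a density, by
  \<open>density_of_minorant\<close>, hence admissible in the GVI problem.\<close>

lemma risk_identifier_imp_solution:
  assumes "dual_of P \<iota>L \<iota>M p \<in> subdifferential R x"
  shows "gvi_solution P \<iota>L \<iota>M V \<sigma> f (\<iota>L p)"
proof -
  obtain r where r: "R x = ereal r" "\<And>y. ereal (r + B p (y - x)) \<le> R y"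
    using assms by (auto simp: dual_of_in_subdifferential_iff)
  have "clL (\<iota>L p) = p" by (rule class_of_eq[OF fs(1)]) simp
  then show ?thesis
    using r density_of_minorant[OF r(2)] by (auto simp: solution_iff in_space_def)
qed

end

end

theorem theorem4:
  fixes P :: "'a measure"
    and \<iota>L :: "'l::banach \<Rightarrow> 'a \<Rightarrow> real"
    and \<iota>M :: "'m::banach \<Rightarrow> 'a \<Rightarrow> real"
    and V :: "'m \<Rightarrow> ereal"
    and \<sigma> :: real
    and m :: "'a \<Rightarrow> 'y \<Rightarrow> real" and y :: "nat \<Rightarrow> 'y" and N :: nat
  assumes "prob_space P" and "complete_measure P"
    and "paired_spaces P \<iota>L \<iota>M"
    and "risk_averse_disutility P \<iota>L \<iota>M V"
    and "\<sigma> > 0"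
    and "N \<ge> 1" and "in_space P \<iota>M (payoff m y N)"
  shows "(\<forall>X. \<exists>t. risk P \<iota>M V X = ereal t + V (X - class_of P \<iota>M (\<lambda>_. t))) \<and>
    ((\<exists>q. gvi_solution P \<iota>L \<iota>M V \<sigma> (payoff m y N) q) \<longleftrightarrow>
      subdifferential (risk P \<iota>M V) (inverse \<sigma> *\<^sub>R class_of P \<iota>M (payoff m y N))
        \<inter> range (dual_of P \<iota>L \<iota>M) \<noteq> {}) \<and>
    (\<forall>q. gvi_solution P \<iota>L \<iota>M V \<sigma> (payoff m y N) q \<longrightarrow>
      in_space P \<iota>L q \<and>
      dual_of P \<iota>L \<iota>M (class_of P \<iota>L q)
        \<in> subdifferential (risk P \<iota>M V) (inverse \<sigma> *\<^sub>R class_of P \<iota>M (payoff m y N))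
          \<inter> range (dual_of P \<iota>L \<iota>M))"
proof -
  interpret risk_duality P \<iota>L \<iota>M V
    using assms(1-4) by (intro risk_duality.intro risk_duality_axioms.intro)
  note imp = solution_imp_risk_identifier[OF \<open>\<sigma> > 0\<close> \<open>in_space P \<iota>M (payoff m y N)\<close>]
    and conv = risk_identifier_imp_solution[OF \<open>\<sigma> > 0\<close> \<open>in_space P \<iota>M (payoff m y N)\<close>]
  show ?thesis
    unfolding risk_eq
  proof (intro conjI allI impI iffI)
    show "\<exists>t. R X = ereal t + V (X - class_of P \<iota>M (\<lambda>_. t))" for X
      using R_attained[of X] unfolding class_of_const[OF fs(2), symmetric] .
    show "dual_of P \<iota>L \<iota>M (clL q) \<in> subdifferential R (inverse \<sigma> *\<^sub>R clM (payoff m y N)) \<inter> range (dual_of P \<iota>L \<iota>M)"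
      if "gvi_solution P \<iota>L \<iota>M V \<sigma> (payoff m y N) q" for q
      using imp(2)[OF that] by (rule IntI) (rule rangeI)
    then show "subdifferential R (inverse \<sigma> *\<^sub>R clM (payoff m y N)) \<inter> range (dual_of P \<iota>L \<iota>M) \<noteq> {}"
      if "\<exists>q. gvi_solution P \<iota>L \<iota>M V \<sigma> (payoff m y N) q"
      using that by (elim exE) (rule ex_in_conv[THEN iffD1, OF exI])
    show "\<exists>q. gvi_solution P \<iota>L \<iota>M V \<sigma> (payoff m y N) q"
      if "subdifferential R (inverse \<sigma> *\<^sub>R clM (payoff m y N)) \<inter> range (dual_of P \<iota>L \<iota>M) \<noteq> {}"
    proof -
      from that obtain p where "dual_of P \<iota>L \<iota>M p \<in> subdifferential R (inverse \<sigma> *\<^sub>R clM (payoff m y N))"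
        by auto
      from conv[OF this] show ?thesis by (rule exI[of _ "\<iota>L p"])
    qed
  qed (rule imp(1))
qed

end
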